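(* Consider solutions in positive integers $n,t,a_1,\dots,a_t$ of the equation $$\prod_{i=1}^{t} a_i!! = n!!, \qquad n>a_1\geq a_2\geq\cdots\geq a_t\geq 3,\quad t>2,$$ with $a_1$ odd and $a_2,\dots,a_t$ even (so that $n$ is even). Write $n=2N$, $a_1=2A_1-1$, $a_i=2A_i$ for $2\le i\le t$, and set $x_1=A_t+1$, $l_1=N-A_t$. Then the following holds. (i) If the explicit abc conjecture holds, then there are only finitely many nontrivial solutions for which none of the factors $x_1,x_1+1,\dots,x_1+l_1-1$ of $\Delta(x_1,l_1)$ is a prime. (ii) Among the solutions for which at least one of the factors $x_1,x_1+1,\dots,x_1+l_1-1$ of $\Delta(x_1,l_1)$ is a prime, there are only finitely many with $x_1>4l_1$; and every such solution with $x_1\leq 4l_1$ satisfies $$0.99\,a_1\leq 4l_1+4.01+\frac{2\log(5)}{\log(2)}+2\,\frac{\log(l_1)}{\log(2)}.$$ In particular, for these latter solutions $a_1$ is bounded whenever $l_1$ is bounded.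
   Context: For a positive integer $m$, $m!!$ denotes the double factorial: $m!!=1\cdot 3\cdots (2l-1)$ if $m=2l-1$ is odd, and $m!!=2\cdot 4\cdots 2l$ if $m=2l$ is even. For positive integers $x,l$ put $\Delta(x,l)=x(x+1)\cdots(x+l-1)$. Here $\log$ is the natural logarithm. With the notation of the claim, put also $x_2=A_2+1$ and $l_2=A_1-A_2$. A solution (with $a_1$ odd and $a_2,\dots,a_t$ even) is called trivial if $l_1=N-A_t=1$ and $l_2=A_1-A_2=1$ (in which case the equation reads $n=a_1!\,a_3!!\cdots a_{t-1}!!$), and nontrivial otherwise. For a non-zero integer $a$, let $N(a)=\prod_{p\mid a}p$ (product over the distinct primes dividing $a$; not to be confused with the integer $N=n/2$). The explicit abc conjecture is the assertion: whenever $a,b,c$ are coprime non-zero integers with $a+b=c$, one has $c<N(abc)^{7/4}$. *)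

theory Defs
  imports Complex_Main "HOL-Computational_Algebra.Primes"
begin

definition double_fact :: "nat \<Rightarrow> nat" where
  "double_fact m =
     (if odd m then \<Prod>i\<in>{1..(m + 1) div 2}. 2 * i - 1
      else \<Prod>i\<in>{1..m div 2}. 2 * i)"

text \<open>
  A tuple \<open>(a\<^sub>1, \<dots>, a\<^sub>t)\<close> is the list \<open>as\<close> with \<open>t = length as\<close>; thus \<open>a\<^sub>1 = hd as\<close>,
  \<open>a\<^sub>2 = as ! 1\<close> and \<open>a\<^sub>t = last as\<close>.
\<close>

definition dfact_solution :: "nat \<Rightarrow> nat list \<Rightarrow> bool" where
  "dfact_solution n as \<longleftrightarrow>
     length as > 2 \<and> n > hd as \<and> sorted_wrt (\<ge>) as \<and> last as \<ge> 3 \<and>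
     (\<Prod>a\<leftarrow>as. double_fact a) = double_fact n"

definition odd_even_solution :: "nat \<Rightarrow> nat list \<Rightarrow> bool" where
  "odd_even_solution n as \<longleftrightarrow>
     dfact_solution n as \<and> odd (hd as) \<and> (\<forall>a\<in>set (tl as). even a)"

text \<open>
  The halved quantities \<open>n = 2N\<close>, \<open>a\<^sub>1 = 2A\<^sub>1 - 1\<close>, \<open>a\<^sub>i = 2A\<^sub>i\<close> are written with \<open>div\<close>; for an
  \<open>odd_even_solution\<close> all these divisions are exact and the subtractions below do not
  truncate (see the lemmas at the end).
\<close>

definition half_n :: "nat \<Rightarrow> nat" where
  "half_n n = n div 2"

definition A_first :: "nat list \<Rightarrow> nat" where
  "A_first as = (hd as + 1) div 2"

definition A_second :: "nat list \<Rightarrow> nat" where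
  "A_second as = (as ! 1) div 2"

definition A_last :: "nat list \<Rightarrow> nat" where
  "A_last as = last as div 2"

definition x\<^sub>1 :: "nat list \<Rightarrow> nat" where
  "x\<^sub>1 as = A_last as + 1"

definition l\<^sub>1 :: "nat \<Rightarrow> nat list \<Rightarrow> nat" where
  "l\<^sub>1 n as = half_n n - A_last as"

definition l\<^sub>2 :: "nat list \<Rightarrow> nat" where
  "l\<^sub>2 as = A_first as - A_second as"

definition trivial_solution :: "nat \<Rightarrow> nat list \<Rightarrow> bool" where
  "trivial_solution n as \<longleftrightarrow> odd_even_solution n as \<and> l\<^sub>1 n as = 1 \<and> l\<^sub>2 as = 1"

definition nontrivial_solution :: "nat \<Rightarrow> nat list \<Rightarrow> bool" where
  "nontrivial_solution n as \<longleftrightarrow> odd_even_solution n as \<and> \<not> trivial_solution n as"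

definition has_prime_factor_term :: "nat \<Rightarrow> nat list \<Rightarrow> bool" where
  "has_prime_factor_term n as \<longleftrightarrow> (\<exists>k\<in>{x\<^sub>1 as..<x\<^sub>1 as + l\<^sub>1 n as}. prime k)"

definition int_radical :: "int \<Rightarrow> int" where
  "int_radical a = \<Prod>(prime_factors a)"

definition explicit_abc :: bool where
  "explicit_abc \<longleftrightarrow>
     (\<forall>a b c :: int. a \<noteq> 0 \<longrightarrow> b \<noteq> 0 \<longrightarrow> c \<noteq> 0 \<longrightarrow> gcd a (gcd b c) = 1 \<longrightarrow> a + b = c \<longrightarrow>
        real_of_int c < real_of_int (int_radical (a * b * c)) powr (7 / 4))"

lemma odd_double_fact_iff: "odd (double_fact m) \<longleftrightarrow> odd m \<or> m = 0"
proof (cases "odd m")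
  case True
  have "odd (\<Prod>i\<in>{1..(m + 1) div 2}. 2 * i - 1 :: nat)"
    by (subst even_prod_iff) auto
  with True show ?thesis by (simp add: double_fact_def)
next
  case False
  show ?thesis
  proof (cases "m = 0")
    case True
    then show ?thesis by (simp add: double_fact_def)
  next
    case m: False
    with False have "1 \<in> {1..m div 2}" by auto
    then have "2 * 1 dvd (\<Prod>i\<in>{1..m div 2}. 2 * i :: nat)"
      by (intro dvd_prodI) auto
    with False m show ?thesis by (simp add: double_fact_def)
  qed
qed

lemma odd_even_solution_exact:
  assumes "odd_even_solution n as"
  shows "n = 2 * half_n n" "hd as = 2 * A_first as - 1" "as ! 1 = 2 * A_second as"
    "last as = 2 * A_last as" "A_last as < half_n n" "A_second as < A_first as"
proof -
  from assms have as: "length as > 2" "n > hd as" "sorted_wrt (\<ge>) as"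
    "(\<Prod>a\<leftarrow>as. double_fact a) = double_fact n" "odd (hd as)"
    "\<And>a. a \<in> set (tl as) \<Longrightarrow> even a" "last as \<ge> 3"
    by (auto simp: odd_even_solution_def dfact_solution_def)
  then obtain a b cs where eq: "as = a # b # cs" and cs: "cs \<noteq> []"
    by (cases as; cases "tl as") auto
  have "even b" using as eq by auto
  have lcs: "last cs \<in> set cs" using cs by simp
  have el: "even (last as)" using as eq cs lcs by auto
  have "b \<ge> last as" "a \<ge> b" using as(3) eq cs lcs by auto
  then have "even (double_fact b)" using odd_double_fact_iff[of b] as(7) \<open>even b\<close> by auto
  then have "even (double_fact n)" using as(4) eq by (auto simp flip: as(4))
  then have en: "even n" using odd_double_fact_iff by blast
  have "a \<noteq> b" using as(5) eq \<open>even b\<close> by auto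
  show "n = 2 * half_n n" "hd as = 2 * A_first as - 1" "as ! 1 = 2 * A_second as"
    "last as = 2 * A_last as" "A_last as < half_n n" "A_second as < A_first as"
    using en el \<open>even b\<close> as(2,5) eq \<open>a \<noteq> b\<close> \<open>b \<ge> last as\<close> \<open>a \<ge> b\<close>
    by (auto simp: half_n_def A_first_def A_second_def A_last_def elim!: evenE oddE)
qed

end

theory Submission
  imports Defs "HOL-Real_Asymp.Real_Asymp"
begin

text \<open>
  Write \<open>N\<close>, \<open>A\<^sub>1\<close>, \<open>A\<^sub>2\<close>, \<open>A\<^sub>t\<close> for the halved quantities. Since the entries decrease, \<open>a\<^sub>t\<close> is the
  smallest of at least three factors, and \<open>A\<^sub>t \<le> A\<^sub>2 < A\<^sub>1 \<le> N\<close>. Everything rests on the single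
  divisibility \<open>a\<^sub>1!! a\<^sub>2!! a\<^sub>t!!\<close> divides \<open>n!! = 2\<^sup>N N!\<close> (\<open>odd_even_solution_dvd\<close>), exploited by
  size and by powers of two.

  Size: the odd factor \<open>a\<^sub>1!!\<close> is no smaller than \<open>a\<^sub>t!!\<close>, so \<open>(a\<^sub>t!!)\<^sup>3 \<le> n!!\<close>. The logarithms of the
  two sides are asymptotic to \<open>3 A\<^sub>t log A\<^sub>t\<close> and \<open>N log N\<close>, so \<open>A\<^sub>t \<ge> c N\<close> is impossible for large
  \<open>N\<close> as soon as \<open>c > 1/3\<close>; the proof takes \<open>c = 2/5\<close>
  (\<open>finite_odd_even_solutions_large_last\<close>). Only finitely many solutions belong to each bounded
  \<open>N\<close>. The condition \<open>x\<^sub>1 > 4 l\<^sub>1\<close> reads \<open>A\<^sub>t \<ge> 4N/5\<close>, so the solutions satisfying it are finite in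
  number.

  Primes: the factors of \<open>\<Delta>(x\<^sub>1, l\<^sub>1)\<close> are the integers in \<open>(A\<^sub>t, N]\<close>. If none of them is prime, then
  every prime dividing \<open>lcm(1, ..., N)\<close> is at most \<open>A\<^sub>t\<close>. This least common multiple is at least
  \<open>2\<^sup>N/(N + 1)\<close>, and it is at most \<open>4\<close> to the power \<open>A\<^sub>t\<close> up to a subexponential factor, because
  the product of the primes up to \<open>A\<close> is at most \<open>4\<close> to the power \<open>A\<close>. So \<open>A\<^sub>t \<ge> (1/2 - o(1)) N\<close>,
  and since \<open>1/2 > 2/5\<close> the size argument leaves finitely many solutions
  (\<open>finite_odd_even_solutions_no_prime\<close>).

  Powers of two: \<open>m!\<close> contains \<open>2\<close> to a power between \<open>m - log\<^sub>2(m + 1)\<close> and \<open>m\<close>. Hence the exponents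
  of \<open>2\<close> in \<open>a\<^sub>2!! a\<^sub>t!!\<close> and in \<open>n!!\<close> give \<open>2A\<^sub>2 + 2A\<^sub>t \<le> 2N + O(log N)\<close> with explicit constants.
  Substituting \<open>N = A\<^sub>t + l\<^sub>1\<close> and \<open>A\<^sub>2 \<ge> A\<^sub>t\<close> turns this into \<open>2N \<le> 4l\<^sub>1 + O(log N)\<close>, and \<open>a\<^sub>1 < 2N\<close>;
  when \<open>x\<^sub>1 \<le> 4l\<^sub>1\<close> one has \<open>N < 5l\<^sub>1\<close>, which produces the explicit bound on \<open>a\<^sub>1\<close>
  (\<open>odd_even_solution_hd_le\<close>).
\<close>

section \<open>A prime between two fifths of N and N\<close>

text \<open>
  Nair's observation: the reciprocals of \<open>k (n choose k)\<close> form the Leibniz harmonic triangle, in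
  which each entry is the difference of the one to its left and the one above that. Since the
  first column consists of the reciprocals of \<open>1, ..., n\<close>, a common multiple \<open>D\<close> of these clears
  the denominators of the whole triangle.
\<close>
lemma Nair_dvd:
  fixes D n k :: nat
  assumes "1 \<le> k" "k \<le> n" "\<And>i. 1 \<le> i \<Longrightarrow> i \<le> n \<Longrightarrow> i dvd D"
  shows "k * (n choose k) dvd D"
  using assms
proof (induction k arbitrary: n rule: dec_induct)
  case base
  then show ?case by simp
next
  case (step k)
  obtain m where n: "n = Suc m" using step.prems by (cases n) auto
  have "k * (n choose k) dvd D"
    using step.prems by (intro step.IH) auto
  then obtain u where u: "D = k * (n choose k) * u" by (elim dvdE)
  have "k * (m choose k) dvd D"
    using step.prems n by (intro step.IH) auto
  then obtain v where v: "D = k * (m choose k) * v" by (elim dvdE)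
  define a b c where "a = int (m choose k)" and "b = int (n choose k)" and "c = int (n choose Suc k)"
  have kpos: "k > 0" using step.hyps by simp
  have apos: "a > 0" using step.prems n by (simp add: a_def)
  have bpos: "b > 0" using step.prems n by (simp add: b_def)
  have 1: "(int k + 1) * c = int n * a"
  proof -
    have "Suc k * (n choose Suc k) = n * (m choose k)"
      unfolding n by (subst Suc_times_binomial_eq) (rule mult.commute)
    then have "int (Suc k) * c = int n * a"
      unfolding a_def c_def by (metis of_nat_mult)
    then show ?thesis by (simp add: add.commute)
  qed
  have 2: "(int n - int k) * b = int n * a"
  proof -
    have "(n - k) * (n choose k) = n * (m choose k)"
      using binomial_absorb_comp[of n k] by (simp add: n)
    then have "int (n - k) * b = int n * a"
      unfolding a_def b_def by (metis of_nat_mult)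
    then show ?thesis using step.prems by (simp add: of_nat_diff)
  qed
  have ui: "int D = int k * b * int u" unfolding b_def by (simp add: u)
  have vi: "int D = int k * a * int v" unfolding a_def by (simp add: v)
  \<comment> \<open>The triangle recurrence says that \<open>D / ((k + 1) c)\<close> is \<open>v - u\<close>; multiplying by \<open>k b\<close> avoids
    fractions.\<close>
  have "int k * b * ((int k + 1) * c * (int v - int u)) = int k * b * int D"
  proof -
    have "int k * b * ((int k + 1) * c * (int v - int u))
        = int n * (b * (int k * a * int v)) - int n * a * (int k * b * int u)"
      unfolding 1 by (simp add: algebra_simps)
    also have "\<dots> = int n * b * int D - (int n - int k) * b * int D"
      unfolding ui[symmetric] vi[symmetric] 2 by simp
    also have "\<dots> = int k * b * int D" by (simp add: algebra_simps)
    finally show ?thesis .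
  qed
  then have "(int k + 1) * c * (int v - int u) = int D"
    using kpos bpos by simp
  then have "int (Suc k * (n choose Suc k)) dvd int D"
    unfolding c_def of_nat_mult of_nat_Suc by (metis dvd_triv_left add.commute)
  then show ?case by (simp only: int_dvd_int_iff)
qed

text \<open>
  The central binomial coefficient is the largest of the \<open>n + 1\<close> in its row, whose sum is \<open>2\<^sup>n\<close>,
  and it divides the least common multiple by the preceding lemma.
\<close>
lemma two_power_le_Lcm:
  fixes n :: nat
  assumes "n \<ge> 2"
  shows "2 ^ n \<le> (n + 1) * Lcm {1..n}"
proof -
  let ?k = "n div 2"
  have "?k * (n choose ?k) dvd Lcm {1..n}"
    using assms by (intro Nair_dvd[where n = n] dvd_Lcm) auto
  moreover have "Lcm {1..n} \<noteq> 0" by (simp add: Lcm_0_iff)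
  ultimately have "?k * (n choose ?k) \<le> Lcm {1..n}"
    by (metis dvd_imp_le gr0I)
  moreover have "1 * (n choose ?k) \<le> ?k * (n choose ?k)"
    using assms by (intro mult_right_mono) auto
  ultimately have le: "(n choose ?k) \<le> Lcm {1..n}" by linarith
  have "2 ^ n = (\<Sum>i\<le>n. n choose i)" by (simp add: choose_row_sum)
  also have "\<dots> \<le> (\<Sum>i\<le>n. n choose ?k)" by (intro sum_mono binomial_maximum)
  also have "\<dots> = (n + 1) * (n choose ?k)" by simp
  also have "\<dots> \<le> (n + 1) * Lcm {1..n}" using le by (intro mult_left_mono) auto
  finally show ?thesis .
qed

lemma prime_power_Lcm_le:
  fixes n p :: nat
  assumes "n \<ge> 1" "prime p"
  shows "p ^ multiplicity p (Lcm {1..n}) \<le> n"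
  using assms(1)
proof (induction n rule: dec_induct)
  case base
  then show ?case by simp
next
  case (step n)
  have "Lcm {1..Suc n} = lcm (Suc n) (Lcm {1..n})"
    by (simp add: atLeastAtMostSuc_conv)
  moreover have "Lcm {1..n} \<noteq> 0" by (simp add: Lcm_0_iff)
  ultimately have "multiplicity p (Lcm {1..Suc n})
      = max (multiplicity p (Suc n)) (multiplicity p (Lcm {1..n}))"
    using assms(2) multiplicity_lcm[of "Suc n" "Lcm {1..n}" p] by (metis nat.distinct(1))
  moreover have "p ^ multiplicity p (Suc n) \<le> Suc n"
    by (intro dvd_imp_le multiplicity_dvd) auto
  ultimately show ?case using step.IH by (auto simp: max_def)
qed

lemma prod_distinct_primes_dvd:
  fixes n :: nat
  assumes "finite Q" "\<And>p. p \<in> Q \<Longrightarrow> prime p \<and> p dvd n"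
  shows "\<Prod>Q dvd n"
  using assms
proof (induction Q rule: finite_induct)
  case (insert p Q)
  have "coprime p (\<Prod>Q)"
    using insert by (intro prod_coprime_right) (auto intro!: primes_coprime)
  then show ?case using insert by (auto intro!: divides_mult)
qed simp

text \<open>
  Erdos' induction: the primes in \<open>(m + 1, 2m + 1]\<close> all divide \<open>2m + 1 choose m\<close>, which is at
  most \<open>4\<^sup>m\<close> because it occurs twice in a row with sum \<open>2 \<cdot> 4\<^sup>m\<close>.
\<close>
lemma primorial_le: "\<Prod>{p::nat. prime p \<and> p \<le> n} \<le> 4 ^ n"
proof (induction n rule: less_induct)
  case (less n)
  consider "n \<le> 2" | m where "n = 2 * m" "m \<ge> 2" | m where "n = 2 * m + 1" "m \<ge> 1"
  proof (cases "n \<le> 2")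
    case False
    define m where "m = n div 2"
    have "n = 2 * m \<or> n = 2 * m + 1" unfolding m_def by presburger
    moreover from this False have "m \<ge> 1" "n = 2 * m \<Longrightarrow> m \<ge> 2" by auto
    ultimately show ?thesis using that(2,3) by blast
  qed (rule that(1))
  then show ?case
  proof cases
    case 1
    show ?thesis
    proof (cases "n = 2")
      case True
      have "p = 2" if "prime p" "p \<le> 2" for p :: nat
        using that prime_ge_2_nat[of p] by linarith
      then have "{p::nat. prime p \<and> p \<le> n} = {2}" using True by auto
      then show ?thesis using True by simp
    next
      case False
      have "\<not> prime p" if "p \<le> n" for p :: nat
        using that prime_ge_2_nat[of p] 1 False by linarith
      then have empty: "{p::nat. prime p \<and> p \<le> n} = {}" by blast
      show ?thesis unfolding empty by simp
    qed
  next
    case (2 m)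
    have np: "\<not> prime n" using 2 prime_odd_nat[of n] by auto
    have "p \<le> n \<longleftrightarrow> p \<le> n - 1" if "prime p" for p
    proof -
      have "p \<noteq> n" using np that by blast
      then show ?thesis by linarith
    qed
    then have eq: "{p::nat. prime p \<and> p \<le> n} = {p::nat. prime p \<and> p \<le> n - 1}" by blast
    have "\<Prod>{p::nat. prime p \<and> p \<le> n - 1} \<le> 4 ^ (n - 1)"
      using 2 by (intro less.IH) auto
    also have "(4::nat) ^ (n - 1) \<le> 4 ^ n" by (intro power_increasing) auto
    finally show ?thesis unfolding eq .
  next
    case (3 m)
    let ?Q = "{p::nat. prime p \<and> m + 1 < p \<and> p \<le> n}"
    have split: "{p::nat. prime p \<and> p \<le> n} = {p. prime p \<and> p \<le> m + 1} \<union> ?Q" using 3 by auto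
    have dvd: "\<Prod>?Q dvd (n choose m)"
    proof (rule prod_distinct_primes_dvd)
      fix p assume p: "p \<in> ?Q"
      have pr: "prime p" and iff: "p dvd fact k \<longleftrightarrow> p \<le> k" for k
        using p prime_dvd_fact_iff[of p k] by auto
      have "fact m * fact (n - m) * (n choose m) = fact n"
        using 3 by (intro binomial_fact_lemma) auto
      moreover have "p dvd fact n" "\<not> p dvd fact m" "\<not> p dvd fact (n - m)"
        using p 3 unfolding iff by auto
      ultimately have "p dvd (n choose m)" using pr by (metis prime_dvd_mult_iff)
      with pr show "prime p \<and> p dvd (n choose m)" ..
    qed simp
    have "2 * (n choose m) = (\<Sum>i\<in>{m, Suc m}. n choose i)"
      using central_binomial_odd[of n] 3 by simp
    also have "\<dots> \<le> (\<Sum>i\<le>n. n choose i)" using 3 by (intro sum_mono2) auto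
    also have "\<dots> = 2 ^ n" by (rule choose_row_sum)
    also have "\<dots> = 2 * 4 ^ m" using 3 by (simp add: power_mult)
    finally have "(n choose m) \<le> 4 ^ m" by simp
    moreover have "\<Prod>?Q \<le> (n choose m)" using dvd 3 by (intro dvd_imp_le) auto
    ultimately have "\<Prod>?Q \<le> 4 ^ m" by (rule order_trans[rotated])
    have "\<Prod>{p::nat. prime p \<and> p \<le> n} = \<Prod>{p. prime p \<and> p \<le> m + 1} * \<Prod>?Q"
      unfolding split by (intro prod.union_disjoint) auto
    also have "\<dots> \<le> 4 ^ (m + 1) * 4 ^ m"
      using 3 \<open>\<Prod>?Q \<le> 4 ^ m\<close> by (intro mult_mono less.IH) auto
    also have "\<dots> = 4 ^ n" using 3 by (simp add: power_add mult_2)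
    finally show ?thesis .
  qed
qed


text \<open>
  In the factorization of \<open>lcm(1, ..., N)\<close> each prime power is at most \<open>N\<close>. The primes up to the
  square root of \<open>N\<close> thus contribute a factor that is subexponential in \<open>N\<close>, and the larger ones
  occur only to the first power, so the primorial bound applies to them.
\<close>
lemma two_power_le_if_no_prime:
  fixes N A :: nat
  assumes "N \<ge> 2" "\<And>p. prime p \<Longrightarrow> p \<le> N \<Longrightarrow> p \<le> A"
  shows "2 ^ N \<le> (real N + 1) * real N powr sqrt (real N) * 4 ^ A"
proof -
  define d where "d = Lcm {1..N}"
  define P where "P = prime_factors d"
  define S where "S = {p \<in> P. p\<^sup>2 \<le> N}"
  have d0: "d > 0" using Lcm_0_iff[of "{1..N}"] by (auto simp: d_def intro!: Nat.gr0I)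
  have le: "p ^ multiplicity p d \<le> N" if "p \<in> P" for p
    using that assms(1) unfolding P_def d_def by (intro prime_power_Lcm_le) auto
  have P: "prime p" "p \<le> A" if "p \<in> P" for p
  proof -
    show pr: "prime p" using that by (auto simp: P_def)
    have "p ^ 1 \<le> p ^ multiplicity p d"
      using that pr d0 unfolding P_def
      by (intro power_increasing) (auto simp: prime_gt_0_nat Suc_le_eq prime_factors_multiplicity)
    with le[OF that] show "p \<le> A" using assms(2)[OF pr] by simp
  qed
  have fin: "finite P" by (simp add: P_def)
  have "d = (\<Prod>p\<in>P. p ^ multiplicity p d)"
    unfolding P_def using d0 by (rule prime_factorization_nat)
  also have "\<dots> \<le> (\<Prod>p\<in>P. (if p\<^sup>2 \<le> N then N else 1) * p)"
  proof (intro prod_mono conjI)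
    fix p assume p: "p \<in> P"
    have p1: "p \<ge> 1" using P(1)[OF p] prime_gt_0_nat[of p] by simp
    show "p ^ multiplicity p d \<le> (if p\<^sup>2 \<le> N then N else 1) * p"
    proof (cases "p\<^sup>2 \<le> N")
      case True
      have "p ^ multiplicity p d * 1 \<le> N * p" using le[OF p] p1 by (rule mult_mono) auto
      with True show ?thesis by simp
    next
      case False
      have "multiplicity p d \<le> 1"
      proof (rule ccontr)
        assume "\<not> ?thesis"
        then have "p ^ 2 \<le> p ^ multiplicity p d" using p1 by (intro power_increasing) auto
        with le[OF p] False show False by linarith
      qed
      then have "p ^ multiplicity p d \<le> p ^ 1" using p1 by (intro power_increasing)
      with False show ?thesis by simp
    qed
  qed auto
  also have "\<dots> = N ^ card S * \<Prod>P"
    using fin by (simp add: prod.distrib S_def prod.If_cases Int_def)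
  also have "\<dots> \<le> N ^ card S * 4 ^ A"
  proof -
    have "\<Prod>P \<le> \<Prod>{p. prime p \<and> p \<le> A}"
      using P by (intro dvd_imp_le prod_dvd_prod_subset) (auto intro!: prod_pos prime_gt_0_nat)
    then show ?thesis using primorial_le[of A] by (intro mult_left_mono) auto
  qed
  finally have "real d \<le> real (N ^ card S * 4 ^ A)" unfolding of_nat_le_iff .
  then have d: "real d \<le> real N ^ card S * 4 ^ A" by simp
  have "S \<subseteq> {1..nat \<lfloor>sqrt (real N)\<rfloor>}"
  proof
    fix p assume p: "p \<in> S"
    then have "p\<^sup>2 \<le> N" "p \<ge> 1" using P(1)[of p] prime_gt_0_nat[of p] by (auto simp: S_def)
    then have "(real p)\<^sup>2 \<le> real N" by (simp flip: of_nat_power)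
    then have "real p \<le> sqrt (real N)" by (rule real_le_rsqrt)
    with \<open>p \<ge> 1\<close> show "p \<in> {1..nat \<lfloor>sqrt (real N)\<rfloor>}" by (simp add: le_nat_floor)
  qed
  then have "real (card S) \<le> real (nat \<lfloor>sqrt (real N)\<rfloor>)"
    unfolding of_nat_le_iff using card_mono[of "{1..nat \<lfloor>sqrt (real N)\<rfloor>}" S] by simp
  also have "real (nat \<lfloor>sqrt (real N)\<rfloor>) \<le> sqrt (real N)" by (simp add: of_nat_floor)
  finally have "real (card S) \<le> sqrt (real N)" by simp
  then have "real N powr real (card S) \<le> real N powr sqrt (real N)"
    using assms(1) by (intro powr_mono) auto
  then have "real N ^ card S \<le> real N powr sqrt (real N)"
    using assms(1) by (simp add: powr_realpow)
  then have d': "real d \<le> real N powr sqrt (real N) * 4 ^ A"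
    using d by (meson mult_right_mono order_trans zero_le_numeral zero_le_power)
  have "real (2 ^ N) \<le> real ((N + 1) * d)"
    using two_power_le_Lcm[OF assms(1)] unfolding d_def of_nat_le_iff .
  also have "\<dots> = (real N + 1) * real d" by (simp add: algebra_simps)
  also have "\<dots> \<le> (real N + 1) * (real N powr sqrt (real N) * 4 ^ A)"
    using d' by (intro mult_left_mono) auto
  finally show ?thesis by (simp add: mult.assoc)
qed

text \<open>
  Any constant below \<open>1/2\<close> would do in place of \<open>2/5\<close>, and any constant above \<open>1/3\<close> suffices for
  the size argument that this is combined with.
\<close>
lemma eventually_prime_in_upper_part:
  "\<forall>\<^sub>F N in sequentially. \<forall>A. 5 * A < 2 * N \<longrightarrow> (\<exists>p. prime p \<and> A < p \<and> p \<le> N)"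
proof -
  have "\<forall>\<^sub>F N in sequentially.
      (real N + 1) * real N powr sqrt (real N) < 2 powr (real N / 5)"
    by real_asymp
  \<comment> \<open>For \<open>A < 2N/5\<close> the factor \<open>4\<^sup>A\<close> uses up \<open>4N/5\<close> of the exponent \<open>N\<close> of \<open>2\<close>; the rest is \<open>N/5\<close>.\<close>
  then show ?thesis using eventually_ge_at_top[of 2]
  proof eventually_elim
    case (elim N)
    show ?case
    proof (intro allI impI, rule ccontr)
      fix A :: nat
      assume A: "5 * A < 2 * N" and no: "\<not> (\<exists>p. prime p \<and> A < p \<and> p \<le> N)"
      have "2 ^ N \<le> (real N + 1) * real N powr sqrt (real N) * 4 ^ A"
        using no elim(2) by (intro two_power_le_if_no_prime) (auto simp: not_less)
      also have "\<dots> \<le> (real N + 1) * real N powr sqrt (real N) * 2 powr (4 / 5 * real N)"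
      proof (intro mult_left_mono)
        have "(4::real) ^ A = 2 ^ (2 * A)" by (simp add: power_mult)
        also have "\<dots> = 2 powr real (2 * A)" by (rule powr_realpow[symmetric]) simp
        also have "\<dots> \<le> 2 powr (4 / 5 * real N)" using A by (intro powr_mono) auto
        finally show "(4::real) ^ A \<le> 2 powr (4 / 5 * real N)" .
      qed auto
      also have "\<dots> < 2 powr (real N / 5) * 2 powr (4 / 5 * real N)"
        using elim(1) by (intro mult_strict_right_mono) auto
      also have "\<dots> = 2 ^ N" by (simp add: powr_realpow flip: powr_add)
      finally show False by simp
    qed
  qed
qed


section \<open>Size of double factorials\<close>


lemma double_fact_even: "double_fact (2 * m) = 2 ^ m * fact m"
  by (simp add: double_fact_def prod.distrib fact_prod)

text \<open>
  Compared factor by factor: \<open>2 \<cdot> 4 \<cdots> 2b\<close> against \<open>3 \<cdot> 5 \<cdots> (2b + 1)\<close>.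
\<close>
lemma double_fact_even_le_odd:
  assumes "b < a"
  shows "double_fact (2 * b) \<le> double_fact (2 * a - 1)"
proof -
  have "double_fact (2 * b) = (\<Prod>i<b. 2 * Suc i)"
    by (simp add: double_fact_def prod.atLeast1_atMost_eq)
  also have "\<dots> \<le> (\<Prod>i<b. 2 * Suc i + 1)" by (intro prod_mono) auto
  also have "\<dots> \<le> (\<Prod>i<Suc b. 2 * i + 1)"
    unfolding prod.lessThan_Suc_shift by simp
  also have "\<dots> \<le> (\<Prod>i<a. 2 * i + 1)"
    using assms by (intro dvd_imp_le prod_dvd_prod_subset prod_pos) auto
  also have "\<dots> = double_fact (2 * a - 1)"
    using assms by (simp add: double_fact_def prod.atLeast1_atMost_eq)
  finally show ?thesis .
qed

lemma double_fact_pos: "double_fact m > 0"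
proof (cases "odd m")
  case False
  then show ?thesis by (auto simp: double_fact_even elim!: evenE)
next
  case True
  then show ?thesis using odd_double_fact_iff[of m] by (auto intro: odd_pos)
qed

lemma double_fact_ge_2:
  assumes "a \<ge> 3"
  shows "double_fact a \<ge> 2"
proof (cases "even a")
  case True
  then obtain b where b: "a = 2 * b" by blast
  with assms have "b \<noteq> 0" by simp
  then have "(2::nat) ^ 1 * 1 \<le> 2 ^ b * fact b" by (intro mult_mono power_increasing) auto
  then show ?thesis by (simp add: b double_fact_even)
next
  case False
  then obtain b where "a = 2 * b + 1" by (elim oddE)
  with assms double_fact_even_le_odd[of 1 "b + 1"] show ?thesis
    using double_fact_even[of 1] by simp
qed

section \<open>The divisibility behind the equation\<close>

lemma odd_even_solution_A_mono:
  assumes "odd_even_solution n as"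
  shows "A_last as \<le> A_second as" "A_first as \<le> half_n n"
proof -
  from assms have as: "length as > 2" "sorted_wrt (\<ge>) as" "n > hd as"
    by (auto simp: odd_even_solution_def dfact_solution_def)
  then have "as ! 1 \<ge> as ! (length as - 1)"
    by (intro sorted_wrt_nth_less[where P = "(\<ge>)"]) auto
  moreover have "last as = as ! (length as - 1)" using as(1) by (intro last_conv_nth) auto
  ultimately show "A_last as \<le> A_second as" by (simp add: A_last_def A_second_def div_le_mono)
  show "A_first as \<le> half_n n"
    using odd_even_solution_exact[OF assms] as(3) by linarith
qed

text \<open>
  Since \<open>t > 2\<close>, the first, second and last entries sit at distinct positions, so their double
  factorials are three separate factors of the product.
\<close>
lemma odd_even_solution_dvd:
  assumes "odd_even_solution n as"
  shows "double_fact (hd as) * double_fact (as ! 1) * double_fact (last as) dvd double_fact n"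
proof -
  from assms have as: "length as > 2" "(\<Prod>a\<leftarrow>as. double_fact a) = double_fact n"
    by (auto simp: odd_even_solution_def dfact_solution_def)
  then obtain a b cs where eq: "as = a # b # cs" and cs: "cs \<noteq> []"
    by (cases as; cases "tl as") auto
  have "(\<Prod>c\<leftarrow>cs. double_fact c) = (\<Prod>c\<leftarrow>butlast cs. double_fact c) * double_fact (last cs)"
    using cs by (subst append_butlast_last_id[OF cs, symmetric]) (simp del: append_butlast_last_id)
  then show ?thesis using as(2) cs by (simp add: eq mult.assoc flip: as(2))
qed

section \<open>Solutions with a large smallest entry\<close>

text \<open>The term of index \<open>n\<close> in the exponential series at \<open>n\<close> is at most the sum.\<close>
lemma fact_ge_power_over_e: "(real n / exp 1) ^ n \<le> fact n"
proof -
  have "(\<Sum>k\<in>{n}. real n ^ k /\<^sub>R fact k) \<le> (\<Sum>k. real n ^ k /\<^sub>R fact k)"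
    by (intro sum_le_suminf summable_exp_generic) auto
  then have "real n ^ n / fact n \<le> exp (real n)" by (simp add: exp_def field_simps)
  also have "\<dots> = exp 1 ^ n" by (simp flip: exp_of_nat_mult)
  finally show ?thesis by (simp add: power_divide field_simps)
qed

text \<open>
  With \<open>A \<ge> 2N/5\<close>, the logarithm of \<open>A!\<^sup>3\<close> is at least \<open>(6/5) N log N - O(N)\<close>, which beats the upper
  bound \<open>N log N + O(N)\<close> for the logarithm of \<open>2\<^sup>N N!\<close>.
\<close>
lemma eventually_cube_double_fact_gt:
  "\<forall>\<^sub>F N in sequentially. \<forall>A. 2 * N \<le> 5 * A \<longrightarrow> double_fact (2 * N) < double_fact (2 * A) ^ 3"
proof -
  have "\<forall>\<^sub>F N in sequentially.
      real N * ln 2 + real N * ln (real N) < 6 / 5 * real N * (ln (2 / 5) + ln (real N) - 1)"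
    by real_asymp
  \<comment> \<open>The base \<open>A/e\<close> must be at least \<open>1\<close> for its powers to increase with the exponent.\<close>
  moreover have "\<forall>\<^sub>F N in sequentially. 1 \<le> 2 / 5 * real N / exp 1"
    by real_asymp
  ultimately show ?thesis using eventually_gt_at_top[of 0]
  proof eventually_elim
    case (elim N)
    show ?case
    proof (intro allI impI)
      fix A :: nat
      assume A: "2 * N \<le> 5 * A"
      have le: "2 / 5 * real N / exp 1 \<le> real A / exp 1"
        using A by (intro divide_right_mono) auto
      have A1: "1 \<le> real A / exp 1" using elim(2) le by linarith
      have "real (double_fact (2 * N)) = 2 ^ N * fact N" by (simp add: double_fact_even)
      also have "\<dots> \<le> 2 ^ N * real N ^ N"
        using fact_le_power[of N, where 'a = real] by (intro mult_left_mono) auto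
      also have "\<dots> = 2 powr real N * real N powr real N" using elim(3) by (simp add: powr_realpow)
      also have "\<dots> = exp (real N * ln 2 + real N * ln (real N))"
        using elim(3) by (simp add: powr_def exp_add)
      also have "\<dots> < exp (6 / 5 * real N * (ln (2 / 5) + ln (real N) - 1))" using elim(1) by simp
      also have "ln (2 / 5) + ln (real N) - 1 = ln (2 / 5 * real N / exp 1)"
        using elim(3) by (simp add: ln_mult ln_div)
      also have "exp (6 / 5 * real N * \<dots>) = (2 / 5 * real N / exp 1) powr (6 / 5 * real N)"
        using elim(3) by (simp add: powr_def)
      also have "\<dots> \<le> (real A / exp 1) powr (6 / 5 * real N)"
        using le by (intro powr_mono2) auto
      also have "\<dots> \<le> (real A / exp 1) powr real (A * 3)"
        using A1 A by (intro powr_mono) auto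
      also have "\<dots> = ((real A / exp 1) ^ A) ^ 3"
        using A1 by (subst powr_realpow) (linarith, simp add: power_mult)
      also have "\<dots> \<le> fact A ^ 3" by (intro power_mono fact_ge_power_over_e) auto
      also have "\<dots> \<le> real (double_fact (2 * A)) ^ 3"
        by (intro power_mono) (auto simp: double_fact_even)
      finally show "double_fact (2 * N) < double_fact (2 * A) ^ 3"
        by (simp flip: of_nat_power)
    qed
  qed
qed

text \<open>
  The entries are at most \<open>n\<close>, and the length is bounded because each double factorial on the left
  is at least \<open>2\<close>.
\<close>
lemma finite_odd_even_solutions_bounded:
  "finite {(n, as). odd_even_solution n as \<and> half_n n \<le> K}"
proof -
  let ?S = "\<lambda>n. {as. set as \<subseteq> {..n} \<and> length as \<le> double_fact n}"
  have "{(n, as). odd_even_solution n as \<and> half_n n \<le> K} \<subseteq> (SIGMA n:{..2 * K}. ?S n)"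
  proof safe
    fix n as assume sol: "odd_even_solution n as" and K: "half_n n \<le> K"
    show "n \<le> 2 * K" using odd_even_solution_exact(1)[OF sol] K by linarith
    from sol have as: "as \<noteq> []" "sorted_wrt (\<ge>) as" "hd as < n" "last as \<ge> 3"
      "(\<Prod>a\<leftarrow>as. double_fact a) = double_fact n"
      by (auto simp: odd_even_solution_def dfact_solution_def)
    have hd: "a \<le> hd as" and last: "last as \<le> a" if a: "a \<in> set as" for a
    proof -
      obtain i where i: "i < length as" "a = as ! i" using a by (auto simp: in_set_conv_nth)
      show "a \<le> hd as"
        using i as(1) sorted_wrt_nth_less[OF as(2), of 0 i] by (cases "i = 0") (auto simp: hd_conv_nth)
      show "last as \<le> a"
        using i as(1) sorted_wrt_nth_less[OF as(2), of i "length as - 1"]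
        by (cases "i = length as - 1") (auto simp: last_conv_nth)
    qed
    show "a \<le> n" if "a \<in> set as" for a using hd[OF that] as(3) by simp
    have "2 ^ length xs \<le> (\<Prod>a\<leftarrow>xs. double_fact a)" if "set xs \<subseteq> set as" for xs
      using that
    proof (induction xs)
      case (Cons x xs)
      have "2 \<le> double_fact x" using Cons.prems last[of x] as(4) by (intro double_fact_ge_2) auto
      with Cons show ?case by (auto intro: mult_mono)
    qed simp
    from this[of as] have "2 ^ length as \<le> double_fact n" using as(5) by simp
    then show "length as \<le> double_fact n"
      using less_exp[of "length as"] by linarith
  qed
  moreover have "finite (SIGMA n:{..2 * K}. ?S n)"
    by (intro finite_SigmaI finite_lists_length_le) auto
  ultimately show ?thesis by (rule finite_subset)
qed

text \<open>
  All three factors in \<open>odd_even_solution_dvd\<close> are at least \<open>a\<^sub>t!!\<close>, so \<open>(a\<^sub>t!!)\<^sup>3 \<le> n!!\<close>, which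
  fails for large \<open>N\<close>.
\<close>
lemma finite_odd_even_solutions_large_last:
  "finite {(n, as). odd_even_solution n as \<and> 2 * half_n n \<le> 5 * A_last as}"
proof -
  obtain K where K: "\<And>N A. N \<ge> K \<Longrightarrow> 2 * N \<le> 5 * A \<Longrightarrow> double_fact (2 * N) < double_fact (2 * A) ^ 3"
    using eventually_cube_double_fact_gt unfolding eventually_sequentially by blast
  have "half_n n \<le> K" if sol: "odd_even_solution n as" and le: "2 * half_n n \<le> 5 * A_last as" for n as
  proof (rule ccontr)
    assume "\<not> ?thesis"
    then have gt: "double_fact n < double_fact (last as) ^ 3"
      using K[of "half_n n" "A_last as"] le odd_even_solution_exact[OF sol] by simp
    note ex = odd_even_solution_exact[OF sol]
    have "A_last as < A_first as" using ex(6) odd_even_solution_A_mono(1)[OF sol] by linarith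
    then have 1: "double_fact (last as) \<le> double_fact (hd as)"
      unfolding ex(2,4) by (rule double_fact_even_le_odd)
    have 2: "double_fact (last as) \<le> double_fact (as ! 1)"
      unfolding ex(3,4) double_fact_even
      using odd_even_solution_A_mono(1)[OF sol] by (intro mult_mono power_increasing fact_mono_nat) auto
    have "double_fact (last as) ^ 3 = double_fact (last as) * double_fact (last as) * double_fact (last as)"
      by (simp add: power3_eq_cube)
    also have "\<dots> \<le> double_fact (hd as) * double_fact (as ! 1) * double_fact (last as)"
      using 1 2 by (intro mult_mono) auto
    also have "\<dots> \<le> double_fact n"
      using odd_even_solution_dvd[OF sol] double_fact_pos by (intro dvd_imp_le)
    finally show False using gt by simp
  qed
  then show ?thesis
    by (intro finite_subset[OF _ finite_odd_even_solutions_bounded[of K]]) auto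
qed

section \<open>Solutions without primes between the smallest entry and N\<close>

lemma has_prime_factor_term_iff:
  assumes "odd_even_solution n as"
  shows "has_prime_factor_term n as \<longleftrightarrow> (\<exists>p. prime p \<and> A_last as < p \<and> p \<le> half_n n)"
  using odd_even_solution_exact(5)[OF assms]
  by (auto simp: has_prime_factor_term_def x\<^sub>1_def l\<^sub>1_def Suc_le_eq less_Suc_eq_le)

lemma finite_odd_even_solutions_no_prime:
  "finite {(n, as). odd_even_solution n as \<and> \<not> has_prime_factor_term n as}"
proof -
  obtain K where K: "\<And>N A :: nat. N \<ge> K \<Longrightarrow> 5 * A < 2 * N \<Longrightarrow> \<exists>p. prime p \<and> A < p \<and> p \<le> N"
    using eventually_prime_in_upper_part unfolding eventually_sequentially by blast
  have "{(n, as). odd_even_solution n as \<and> \<not> has_prime_factor_term n as}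
      \<subseteq> {(n, as). odd_even_solution n as \<and> half_n n \<le> K}
        \<union> {(n, as). odd_even_solution n as \<and> 2 * half_n n \<le> 5 * A_last as}"
  proof safe
    fix n as
    assume sol: "odd_even_solution n as" and no: "\<not> has_prime_factor_term n as"
      and lt: "\<not> 2 * half_n n \<le> 5 * A_last as"
    show "half_n n \<le> K"
    proof (rule ccontr)
      assume "\<not> ?thesis"
      then have "\<exists>p. prime p \<and> A_last as < p \<and> p \<le> half_n n" using lt by (intro K) auto
      with no show False unfolding has_prime_factor_term_iff[OF sol] by blast
    qed
  qed
  then show ?thesis
    using finite_odd_even_solutions_bounded finite_odd_even_solutions_large_last
    by (meson finite_UnI finite_subset)
qed

section \<open>Powers of two\<close>

lemma multiplicity_2_fact_double:
  "multiplicity 2 (fact (2 * k) :: nat) = k + multiplicity 2 (fact k :: nat)"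
proof (induction k)
  case (Suc k)
  have p: "prime_elem (2::nat)" by simp
  have "(fact (2 * Suc k) :: nat) = 2 * Suc k * ((2 * k + 1) * fact (2 * k))"
    by (simp add: algebra_simps)
  moreover have "multiplicity 2 (2 * k + 1) = 0" by (intro not_dvd_imp_multiplicity_0) simp
  ultimately have "multiplicity 2 (fact (2 * Suc k) :: nat)
      = 1 + multiplicity 2 (Suc k) + multiplicity 2 (fact (2 * k) :: nat)"
    using p by (simp add: prime_elem_multiplicity_mult_distrib del: fact_Suc mult_Suc_right mult_Suc)
  also have "\<dots> = Suc k + (multiplicity 2 (Suc k) + multiplicity 2 (fact k :: nat))"
    by (simp add: Suc.IH)
  also have "multiplicity 2 (Suc k) + multiplicity 2 (fact k :: nat) = multiplicity 2 (fact (Suc k) :: nat)"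
    using p by (simp add: prime_elem_multiplicity_mult_distrib del: mult_Suc)
  finally show ?case .
qed simp

lemma multiplicity_2_fact_double_Suc:
  "multiplicity 2 (fact (2 * k + 1) :: nat) = k + multiplicity 2 (fact k :: nat)"
proof -
  have "(fact (2 * k + 1) :: nat) = (2 * k + 1) * fact (2 * k)" by simp
  then have "multiplicity 2 (fact (2 * k + 1) :: nat) = multiplicity 2 ((2 * k + 1) * fact (2 * k))"
    by (rule arg_cong)
  also have "\<dots> = multiplicity 2 (2 * k + 1) + multiplicity 2 (fact (2 * k) :: nat)"
    by (intro prime_elem_multiplicity_mult_distrib) auto
  also have "multiplicity 2 (2 * k + 1) = 0" by (intro not_dvd_imp_multiplicity_0) simp
  finally show ?thesis by (simp only: multiplicity_2_fact_double)
qed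

text \<open>
  By Legendre's formula \<open>m\<close> minus the exponent is the binary digit sum of \<open>m\<close>, and \<open>2\<close> to the
  power of the digit sum is at most \<open>m + 1\<close>. Halving \<open>m\<close> drops the last digit, which gives an
  induction without digit sums.
\<close>
lemma multiplicity_2_fact_bounds:
  "multiplicity 2 (fact m :: nat) \<le> m \<and> 2 ^ m \<le> (m + 1) * 2 ^ multiplicity 2 (fact m :: nat)"
proof (induction m rule: less_induct)
  case (less m)
  define k where "k = m div 2"
  show ?case
  proof (cases "m = 0")
    case False
    then have "k < m" by (simp add: k_def)
    note IH = less.IH[OF this]
    have "m = 2 * k \<or> m = 2 * k + 1" unfolding k_def by presburger
    then show ?thesis
    proof
      assume m: "m = 2 * k"
      have "(2::nat) ^ m = 2 ^ k * 2 ^ k" by (simp add: m mult_2 power_add)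
      also have "\<dots> \<le> 2 ^ k * ((k + 1) * 2 ^ multiplicity 2 (fact k :: nat))"
        using IH by (intro mult_left_mono) auto
      also have "\<dots> \<le> 2 ^ k * ((m + 1) * 2 ^ multiplicity 2 (fact k :: nat))"
        by (intro mult_left_mono mult_right_mono) (auto simp: m)
      also have "\<dots> = (m + 1) * 2 ^ multiplicity 2 (fact m :: nat)"
        unfolding m multiplicity_2_fact_double power_add by (simp add: algebra_simps)
      finally show ?thesis using IH by (simp add: m multiplicity_2_fact_double)
    next
      assume m: "m = 2 * k + 1"
      have "(2::nat) ^ m = 2 * (2 ^ k * 2 ^ k)" by (simp add: m mult_2 power_add)
      also have "\<dots> \<le> 2 * (2 ^ k * ((k + 1) * 2 ^ multiplicity 2 (fact k :: nat)))"
        using IH by (intro mult_left_mono) auto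
      also have "\<dots> = (2 * (k + 1)) * (2 ^ k * 2 ^ multiplicity 2 (fact k :: nat))"
        by (simp only: mult_ac)
      also have "\<dots> = (m + 1) * 2 ^ multiplicity 2 (fact m :: nat)"
        unfolding m multiplicity_2_fact_double_Suc power_add by simp
      finally show ?thesis using IH unfolding m multiplicity_2_fact_double_Suc by linarith
    qed
  qed simp
qed

lemma multiplicity_2_fact_ge:
  "real m - log 2 (real m + 1) \<le> real (multiplicity 2 (fact m :: nat))"
proof -
  let ?v = "multiplicity 2 (fact m :: nat)"
  have "real (2 ^ m) \<le> real ((m + 1) * 2 ^ ?v)"
    using multiplicity_2_fact_bounds unfolding of_nat_le_iff by blast
  then have "log 2 (2 ^ m) \<le> log 2 ((real m + 1) * 2 ^ ?v)"
    by (intro log_mono) (simp_all add: algebra_simps)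
  then show ?thesis by (simp add: log_mult log_nat_power)
qed

text \<open>
  The exponent of \<open>2\<close> in \<open>(2m)!!\<close> is \<open>m\<close> plus that in \<open>m!\<close>, hence \<open>2m\<close> up to a logarithm. It remains to
  compare the two even factors \<open>a\<^sub>2!! a\<^sub>t!!\<close> with \<open>n!!\<close>.
\<close>
lemma odd_even_solution_two_adic:
  assumes "odd_even_solution n as"
  defines "N \<equiv> half_n n" and "A \<equiv> A_last as" and "B \<equiv> A_second as"
  shows "2 * real A + 2 * real B
           \<le> 2 * real N + log 2 (real A + 1) + log 2 (real B + 1)"
proof -
  let ?v = "\<lambda>m. multiplicity 2 (fact m :: nat)"
  note ex = odd_even_solution_exact[OF assms(1), folded N_def A_def B_def]
  have p: "prime_elem (2::nat)" by simp
  have mult: "multiplicity 2 (double_fact (2 * m)) = m + ?v m" for m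
    using p by (simp add: double_fact_even prime_elem_multiplicity_mult_distrib)
  have "double_fact (2 * B) * double_fact (2 * A) dvd double_fact (2 * N)"
    using odd_even_solution_dvd[OF assms(1)] ex(1,3,4) by (metis dvd_mult_right mult.assoc)
  then have "multiplicity 2 (double_fact (2 * B) * double_fact (2 * A))
      \<le> multiplicity 2 (double_fact (2 * N))"
    using double_fact_pos[of "2 * N"] by (intro dvd_imp_multiplicity_le) auto
  then have "B + ?v B + (A + ?v A) \<le> N + ?v N"
    using p double_fact_pos[of "2 * A"] double_fact_pos[of "2 * B"]
    by (simp add: prime_elem_multiplicity_mult_distrib mult)
  also have "\<dots> \<le> N + N" using multiplicity_2_fact_bounds by simp
  finally have "real (B + ?v B + (A + ?v A)) \<le> real (N + N)" unfolding of_nat_le_iff .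
  then show ?thesis using multiplicity_2_fact_ge[of A] multiplicity_2_fact_ge[of B] by simp
qed

text \<open>
  The hypothesis serves to bound the two logarithms in the 2-adic inequality by that of
  \<open>5 l\<^sub>1\<close>, since \<open>A\<^sub>t < 4 l\<^sub>1\<close> and \<open>A\<^sub>2 < N = A\<^sub>t + l\<^sub>1\<close>.
\<close>
lemma odd_even_solution_hd_le:
  assumes sol: "odd_even_solution n as" and le: "x\<^sub>1 as \<le> 4 * l\<^sub>1 n as"
  shows "real (hd as) \<le> 4 * real (l\<^sub>1 n as) + 2 * log 2 (5 * real (l\<^sub>1 n as))"
proof -
  define N A B L where "N = half_n n" and "A = A_last as" and "B = A_second as" and "L = l\<^sub>1 n as"
  note ex = odd_even_solution_exact[OF sol, folded N_def A_def B_def]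
  note mono = odd_even_solution_A_mono[OF sol, folded N_def A_def B_def]
  have L: "N = A + L" "L > 0" using ex(5) by (auto simp: L_def l\<^sub>1_def N_def A_def)
  have A: "A + 1 \<le> 4 * L" using le by (simp add: x\<^sub>1_def A_def L_def)
  have "A + 1 \<le> 5 * L" "B + 1 \<le> 5 * L" using A L ex(6) mono by linarith+
  then have "real (A + 1) \<le> real (5 * L)" "real (B + 1) \<le> real (5 * L)"
    unfolding of_nat_le_iff .
  then have "log 2 (real A + 1) \<le> log 2 (5 * real L)" "log 2 (real B + 1) \<le> log 2 (5 * real L)"
    by (simp_all add: add.commute)
  then have "2 * real A + 2 * real B \<le> 2 * real N + 2 * log 2 (5 * real L)"
    using odd_even_solution_two_adic[OF sol, folded N_def A_def B_def] by linarith
  moreover have "real A \<le> real B" "real N = real A + real L" using mono(1) L by simp_all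
  ultimately have "2 * real N \<le> 4 * real L + 2 * log 2 (5 * real L)" by linarith
  moreover have "real (hd as) \<le> real (2 * N)"
    unfolding of_nat_le_iff using ex(2) mono(2) by linarith
  ultimately show ?thesis unfolding L_def by simp
qed

theorem theorem1p2:
  shows "(explicit_abc \<longrightarrow>
            finite {(n, as). nontrivial_solution n as \<and> \<not> has_prime_factor_term n as})
       \<and> finite {(n, as). odd_even_solution n as \<and> has_prime_factor_term n as \<and>
                          x\<^sub>1 as > 4 * l\<^sub>1 n as}
       \<and> (\<forall>n as. odd_even_solution n as \<longrightarrow> has_prime_factor_term n as \<longrightarrow>
              x\<^sub>1 as \<le> 4 * l\<^sub>1 n as \<longrightarrow>
              0.99 * real (hd as) \<le>
                4 * real (l\<^sub>1 n as) + 4.01 + 2 * ln 5 / ln 2 + 2 * (ln (real (l\<^sub>1 n as)) / ln 2))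
       \<and> (\<forall>L. \<exists>B. \<forall>n as. odd_even_solution n as \<longrightarrow> has_prime_factor_term n as \<longrightarrow>
              x\<^sub>1 as \<le> 4 * l\<^sub>1 n as \<longrightarrow> l\<^sub>1 n as \<le> L \<longrightarrow> hd as \<le> B)"
proof (intro conjI impI allI)
  show "finite {(n, as). nontrivial_solution n as \<and> \<not> has_prime_factor_term n as}"
    by (rule finite_subset[OF _ finite_odd_even_solutions_no_prime])
      (auto simp: nontrivial_solution_def)
next
  show "finite {(n, as). odd_even_solution n as \<and> has_prime_factor_term n as \<and>
                          x\<^sub>1 as > 4 * l\<^sub>1 n as}"
    by (rule finite_subset[OF _ finite_odd_even_solutions_large_last])
      (auto simp: x\<^sub>1_def l\<^sub>1_def)
next
  fix n as
  assume sol: "odd_even_solution n as" and le: "x\<^sub>1 as \<le> 4 * l\<^sub>1 n as"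
  have "l\<^sub>1 n as > 0" using odd_even_solution_exact(5)[OF sol] by (simp add: l\<^sub>1_def)
  then have "log 2 (5 * real (l\<^sub>1 n as)) = ln 5 / ln 2 + ln (real (l\<^sub>1 n as)) / ln 2"
    by (simp add: log_def ln_mult add_divide_distrib)
  then show "0.99 * real (hd as) \<le>
                4 * real (l\<^sub>1 n as) + 4.01 + 2 * ln 5 / ln 2 + 2 * (ln (real (l\<^sub>1 n as)) / ln 2)"
    using odd_even_solution_hd_le[OF sol le] by simp
next
  fix L :: nat
  show "\<exists>B. \<forall>n as. odd_even_solution n as \<longrightarrow> has_prime_factor_term n as \<longrightarrow>
              x\<^sub>1 as \<le> 4 * l\<^sub>1 n as \<longrightarrow> l\<^sub>1 n as \<le> L \<longrightarrow> hd as \<le> B"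
  proof (rule exI[of _ "10 * L"], safe)
    fix n as
    assume sol: "odd_even_solution n as" and "x\<^sub>1 as \<le> 4 * l\<^sub>1 n as" "l\<^sub>1 n as \<le> L"
    then have "half_n n \<le> 5 * L" by (simp add: x\<^sub>1_def l\<^sub>1_def)
    then show "hd as \<le> 10 * L"
      using odd_even_solution_exact(2)[OF sol] odd_even_solution_A_mono(2)[OF sol] by linarith
  qed
qed

end
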